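(* Fix an integer $n\ge1$ and $R>0$, and consider homogeneous isotropic extended Burgers models on the ball of radius $R$, i.e. real constants $\eta_i>0$, $\lambda_i$, $\mu_i$ ($0\le i\le n$) with $\mu_i>0$ and $3\lambda_i+2\mu_i>0$, such that the relaxation rates satisfy $\tau_0<\tau_1<\cdots<\tau_n<\kappa_0<\kappa_1<\cdots<\kappa_n$. For $\ell\in\mathbb{N}$, $\ell\geq 1$, the cluster of eigenvalues associated with $\ell$ is the collection of the $2n+4$ complex roots (with multiplicity) of the polynomial $$P^\ell_{2n+4}(z)=\Big((\lambda_0+2\mu_0)+\frac{R^2}{r_\ell^2}z^2\Big)\prod_{1\le j\le 2n+2}(z+\beta_j)-\sum_{i=1}^{2n+2}\alpha_i\prod_{1\le j\le 2n+2,\,j\ne i}(z+\beta_j).$$ Let $\ell_1\ne\ell_2$ be two positive integers. Then the two clusters of eigenvalues associated with $\ell=\ell_1$ and $\ell=\ell_2$ determine $\alpha_j,\beta_j$ ($1\le j\le 2n+2$) and $\lambda_0+2\mu_0$. That is, if two such models have the same cluster of eigenvalues for $\ell=\ell_1$ and the same cluster of eigenvalues for $\ell=\ell_2$, then they have the same values of $\alpha_j$, $\beta_j$ ($1\le j\le 2n+2$) and of $\lambda_0+2\mu_0$.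
   Context: Put $b:=\sum_{i=0}^n\eta_i^{-1}$; rows and columns of $(n+1)\times(n+1)$ matrices are indexed by $0,\dots,n$. $L_1^S$ is the real symmetric matrix with $(L_1^S)_{00}=-2b\mu_0$, $(L_1^S)_{ii}=-2\mu_i\eta_i^{-1}$, $(L_1^S)_{0i}=(L_1^S)_{i0}=\eta_i^{-1}\big((2\mu_0)(2\mu_i)\big)^{1/2}$ for $1\le i\le n$, other entries $0$. $L_0^S$ is the real symmetric matrix with $(L_0^S)_{00}=-b(3\lambda_0+2\mu_0)$, $(L_0^S)_{ii}=-\eta_i^{-1}(3\lambda_i+2\mu_i)$, $(L_0^S)_{0i}=(L_0^S)_{i0}=\eta_i^{-1}\sqrt{(3\lambda_0+2\mu_0)(3\lambda_i+2\mu_i)}$ for $1\le i\le n$, other entries $0$. Both are negative definite. Let $-\tau_0,\dots,-\tau_n$ be the eigenvalues of $L_1^S$ with orthonormal eigenvectors $v^0,\dots,v^n$ ($L_1^Sv^j=-\tau_jv^j$), and $-\kappa_0,\dots,-\kappa_n$ the eigenvalues of $L_0^S$ with orthonormal eigenvectors $q^0,\dots,q^n$ ($L_0^Sq^j=-\kappa_jq^j$); $v_0^j$, $q_0^j$ denote the components with index $0$. For $0\le j\le n$ set $$\beta_{j+1}=\tau_j,\quad \alpha_{j+1}=\tfrac43\mu_0\tau_j(v_0^j)^2,\quad \beta_{j+n+2}=\kappa_j,\quad \alpha_{j+n+2}=\big(\lambda_0+\tfrac23\mu_0\big)\kappa_j(q_0^j)^2 .$$ For each $\ell=1,2,\dots$,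 $r_\ell$ denotes the unique root in $((\ell-1)\pi,\ell\pi)$ of $$f(\eta)=\big((\lambda_0+2\mu_0)\eta^2-4\mu_0\big)\sin\eta+4\mu_0\eta\cos\eta ,$$ so $r_\ell$ depends on the model through $\lambda_0,\mu_0$. *)

theory Defs
  imports Complex_Main "HOL-Computational_Algebra.Polynomial" "Jordan_Normal_Form.Char_Poly"
begin

text \<open>
  An extended Burgers model is given by the constants \<open>\<eta> i\<close>, \<open>lam i\<close> (the Lame parameter
  \<open>\<lambda>\<^sub>i\<close>) and \<open>\<mu> i\<close> for \<open>0 \<le> i \<le> n\<close>; values of these functions at indices above \<open>n\<close> are
  never used.
\<close>

definition burgers_model ::
    "nat \<Rightarrow> (nat \<Rightarrow> real) \<Rightarrow> (nat \<Rightarrow> real) \<Rightarrow> (nat \<Rightarrow> real) \<Rightarrow> bool" where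
  "burgers_model n \<eta> lam \<mu> \<longleftrightarrow>
     (\<forall>i\<le>n. \<eta> i > 0 \<and> \<mu> i > 0 \<and> 3 * lam i + 2 * \<mu> i > 0)"

definition inv_visc_sum :: "nat \<Rightarrow> (nat \<Rightarrow> real) \<Rightarrow> real" where
  "inv_visc_sum n \<eta> = (\<Sum>i=0..n. inverse (\<eta> i))"

definition L1S :: "nat \<Rightarrow> (nat \<Rightarrow> real) \<Rightarrow> (nat \<Rightarrow> real) \<Rightarrow> real mat" where
  "L1S n \<eta> \<mu> = mat (n + 1) (n + 1) (\<lambda>(i, j).
     if i = 0 \<and> j = 0 then - 2 * inv_visc_sum n \<eta> * \<mu> 0
     else if i = j then - 2 * \<mu> i * inverse (\<eta> i)
     else if i = 0 then inverse (\<eta> j) * sqrt ((2 * \<mu> 0) * (2 * \<mu> j))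
     else if j = 0 then inverse (\<eta> i) * sqrt ((2 * \<mu> 0) * (2 * \<mu> i))
     else 0)"

definition L0S :: "nat \<Rightarrow> (nat \<Rightarrow> real) \<Rightarrow> (nat \<Rightarrow> real) \<Rightarrow> (nat \<Rightarrow> real) \<Rightarrow> real mat" where
  "L0S n \<eta> lam \<mu> = mat (n + 1) (n + 1) (\<lambda>(i, j).
     if i = 0 \<and> j = 0 then - inv_visc_sum n \<eta> * (3 * lam 0 + 2 * \<mu> 0)
     else if i = j then - inverse (\<eta> i) * (3 * lam i + 2 * \<mu> i)
     else if i = 0 then
       inverse (\<eta> j) * sqrt ((3 * lam 0 + 2 * \<mu> 0) * (3 * lam j + 2 * \<mu> j))
     else if j = 0 then
       inverse (\<eta> i) * sqrt ((3 * lam 0 + 2 * \<mu> 0) * (3 * lam i + 2 * \<mu> i))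
     else 0)"

text \<open>
  The vectors \<open>v 0, \<dots>, v n\<close> are orthonormal eigenvectors of \<open>A\<close>, of size \<open>n + 1\<close>, for
  \<open>- \<sigma> 0, \<dots>, - \<sigma> n\<close>. Being \<open>n + 1\<close> in number they form a basis, so the numbers
  \<open>- \<sigma> j\<close> are all the eigenvalues of \<open>A\<close>, with multiplicity.
\<close>

definition orthonormal_eigensystem ::
    "nat \<Rightarrow> real mat \<Rightarrow> (nat \<Rightarrow> real) \<Rightarrow> (nat \<Rightarrow> real vec) \<Rightarrow> bool" where
  "orthonormal_eigensystem n A \<sigma> v \<longleftrightarrow>
     (\<forall>j\<le>n. eigenvector A (v j) (- \<sigma> j)) \<and>
     (\<forall>i\<le>n. \<forall>j\<le>n. v i \<bullet> v j = (if i = j then 1 else 0))"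

text \<open>The values of \<open>beta\<close> and \<open>alpha\<close> are meaningful for indices in \<open>{1..2 * n + 2}\<close>.\<close>

definition beta :: "nat \<Rightarrow> (nat \<Rightarrow> real) \<Rightarrow> (nat \<Rightarrow> real) \<Rightarrow> nat \<Rightarrow> real" where
  "beta n \<tau> \<kappa> i = (if i \<le> n + 1 then \<tau> (i - 1) else \<kappa> (i - (n + 2)))"

definition alpha ::
    "nat \<Rightarrow> (nat \<Rightarrow> real) \<Rightarrow> (nat \<Rightarrow> real) \<Rightarrow> (nat \<Rightarrow> real) \<Rightarrow> (nat \<Rightarrow> real vec) \<Rightarrow>
     (nat \<Rightarrow> real) \<Rightarrow> (nat \<Rightarrow> real vec) \<Rightarrow> nat \<Rightarrow> real" where
  "alpha n lam \<mu> \<tau> v \<kappa> q i =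
     (if i \<le> n + 1 then 4 / 3 * \<mu> 0 * \<tau> (i - 1) * (v (i - 1) $ 0)\<^sup>2
      else (lam 0 + 2 / 3 * \<mu> 0) * \<kappa> (i - (n + 2)) * (q (i - (n + 2)) $ 0)\<^sup>2)"

definition char_fun :: "real \<Rightarrow> real \<Rightarrow> real \<Rightarrow> real" where
  "char_fun l m x = ((l + 2 * m) * x\<^sup>2 - 4 * m) * sin x + 4 * m * x * cos x"

text \<open>
  Dividing \<open>char_fun l m x\<close> by \<open>x\<^sup>2 sin x\<close> leaves a strictly decreasing function on
  each of the intervals below, with a sign change, so the root exists and is unique when \<open>m > 0\<close> and \<open>3 * l + 2 * m > 0\<close>.
\<close>

definition char_root :: "real \<Rightarrow> real \<Rightarrow> nat \<Rightarrow> real" where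
  "char_root l m k =
     (THE x. (real k - 1) * pi < x \<and> x < real k * pi \<and> char_fun l m x = 0)"

definition cluster_poly ::
    "nat \<Rightarrow> real \<Rightarrow> real \<Rightarrow> real \<Rightarrow> (nat \<Rightarrow> real) \<Rightarrow> (nat \<Rightarrow> real) \<Rightarrow> real poly" where
  "cluster_poly n R c r a b =
     [:c, 0, R\<^sup>2 / r\<^sup>2:] * (\<Prod>j\<in>{1..2*n+2}. [:b j, 1:])
     - (\<Sum>i\<in>{1..2*n+2}. Polynomial.smult (a i) (\<Prod>j\<in>{1..2*n+2} - {i}. [:b j, 1:]))"

definition cluster ::
    "nat \<Rightarrow> real \<Rightarrow> (nat \<Rightarrow> real) \<Rightarrow> (nat \<Rightarrow> real) \<Rightarrow> (nat \<Rightarrow> real) \<Rightarrow> (nat \<Rightarrow> real vec) \<Rightarrow>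
     (nat \<Rightarrow> real) \<Rightarrow> (nat \<Rightarrow> real vec) \<Rightarrow> nat \<Rightarrow> complex multiset" where
  "cluster n R lam \<mu> \<tau> v \<kappa> q k =
     proots (map_poly complex_of_real
       (cluster_poly n R (lam 0 + 2 * \<mu> 0) (char_root (lam 0) (\<mu> 0) k)
          (alpha n lam \<mu> \<tau> v \<kappa> q) (beta n \<tau> \<kappa>)))"

text \<open>
  The ordering makes the eigenvalues of each of the two matrices simple, so \<open>\<tau>\<close> and \<open>\<kappa>\<close> are determined by
  the model on \<open>{0..n}\<close>, the eigenvectors are determined up to sign, and \<open>alpha\<close>, \<open>beta\<close>
  and \<open>cluster\<close> depend on the model only.
\<close>

definition ordered_spectrum ::
    "nat \<Rightarrow> (nat \<Rightarrow> real) \<Rightarrow> (nat \<Rightarrow> real) \<Rightarrow> (nat \<Rightarrow> real) \<Rightarrow>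
     (nat \<Rightarrow> real) \<Rightarrow> (nat \<Rightarrow> real vec) \<Rightarrow> (nat \<Rightarrow> real) \<Rightarrow> (nat \<Rightarrow> real vec) \<Rightarrow> bool" where
  "ordered_spectrum n \<eta> lam \<mu> \<tau> v \<kappa> q \<longleftrightarrow>
     orthonormal_eigensystem n (L1S n \<eta> \<mu>) \<tau> v \<and>
     orthonormal_eigensystem n (L0S n \<eta> lam \<mu>) \<kappa> q \<and>
     strict_mono_on {0..n} \<tau> \<and> \<tau> n < \<kappa> 0 \<and> strict_mono_on {0..n} \<kappa>"

end

theory Submission
  imports Defs "HOL-Computational_Algebra.Fundamental_Theorem_Algebra"
begin

text \<open>
  Write \<open>B\<close> for the product of the factors \<open>z + \<beta>\<^sub>j\<close>, \<open>c = \<lambda>\<^sub>0 + 2 \<mu>\<^sub>0\<close> and \<open>t = r\<^sup>2 / R\<^sup>2\<close>.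
  Orthonormality of the two eigenbases gives \<open>\<Sum> \<alpha>\<^sub>i / \<beta>\<^sub>i = c\<close> (\<open>sum_a_over_b\<close>), so the
  cluster polynomial vanishes at the origin: it is \<open>z (z B / t + E)\<close>, where \<open>E\<close> is the sum of
  the \<open>(\<alpha>\<^sub>i / \<beta>\<^sub>i) \<Prod>\<^sub>j\<^sub>\<noteq>\<^sub>i (z + \<beta>\<^sub>j)\<close> (\<open>cluster_poly_factor\<close>). The cluster determines its
  polynomial up to its leading coefficient \<open>1 / t\<close>, hence it determines \<open>z B + t E\<close>.

  Suppose a second model, written with primes, has the same two clusters. Then
  \<open>z B + t\<^sub>i E = z B' + t\<^sub>i' E'\<close> for \<open>i = 1, 2\<close>. At \<open>z = 0\<close> this reads
  \<open>t\<^sub>i E(0) = t\<^sub>i' E'(0)\<close>, and \<open>E'(0) > 0\<close> because the rates are positive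
  (\<open>relaxation_rate_pos\<close>). So \<open>t\<^sub>i' = s t\<^sub>i\<close> with one \<open>s\<close> for both \<open>i\<close>; subtracting the two
  equations gives \<open>E = s E'\<close>, as \<open>t\<^sub>1 \<noteq> t\<^sub>2\<close>, and then \<open>B = B'\<close>
  (\<open>two_normalised_clusters_rigid\<close>). The increasing order of the \<open>\<beta>\<^sub>j\<close> turns \<open>B = B'\<close> into
  \<open>\<beta> = \<beta>'\<close>, and comparing \<open>E\<close> with \<open>E'\<close> at \<open>- \<beta>\<^sub>i\<close> gives \<open>\<alpha> = s \<alpha>'\<close>.

  It remains to see that \<open>s = 1\<close>. The first \<open>n + 1\<close> of the \<open>\<alpha>\<^sub>i\<close> add up to \<open>8 b \<mu>\<^sub>0\<^sup>2 / 3\<close> and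
  the last \<open>n + 1\<close> to \<open>b (3 \<lambda>\<^sub>0 + 2 \<mu>\<^sub>0)\<^sup>2 / 3\<close>. The quotient of these sums is blind to \<open>s\<close> and
  fixes \<open>\<lambda>\<^sub>0 / \<mu>\<^sub>0\<close>. The function \<open>f\<close> is homogeneous in \<open>(\<lambda>\<^sub>0, \<mu>\<^sub>0)\<close>, so its roots depend on that
  ratio only and agree for the two models (\<open>proportional_residues_imp_same_roots\<close>). Thus
  \<open>t\<^sub>1' = t\<^sub>1 > 0\<close> and \<open>s = 1\<close>.
\<close>

section \<open>Spectral data of the relaxation matrices\<close>

text \<open>
  The two relaxation matrices have one shape, with weights \<open>p i = 2 * \<mu> i\<close> for the shear
  part and \<open>p i = 3 * lam i + 2 * \<mu> i\<close> for the bulk part.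
\<close>

definition relaxation_mat :: "nat \<Rightarrow> (nat \<Rightarrow> real) \<Rightarrow> (nat \<Rightarrow> real) \<Rightarrow> real mat" where
  "relaxation_mat n \<eta> p = mat (n + 1) (n + 1) (\<lambda>(i, j).
     if i = 0 \<and> j = 0 then - inv_visc_sum n \<eta> * p 0
     else if i = j then - p i * inverse (\<eta> i)
     else if i = 0 then inverse (\<eta> j) * sqrt (p 0 * p j)
     else if j = 0 then inverse (\<eta> i) * sqrt (p 0 * p i)
     else 0)"

lemma L1S_eq_relaxation_mat: "L1S n \<eta> \<mu> = relaxation_mat n \<eta> (\<lambda>i. 2 * \<mu> i)"
  unfolding L1S_def relaxation_mat_def by (intro eq_matI) auto

lemma L0S_eq_relaxation_mat: "L0S n \<eta> lam \<mu> = relaxation_mat n \<eta> (\<lambda>i. 3 * lam i + 2 * \<mu> i)"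
  unfolding L0S_def relaxation_mat_def by (intro eq_matI) (auto simp: algebra_simps)

lemma relaxation_mat_carrier: "relaxation_mat n \<eta> p \<in> carrier_mat (n + 1) (n + 1)"
  unfolding relaxation_mat_def by simp

lemma relaxation_mat_mult_vec_index:
  assumes "x \<in> carrier_vec (n + 1)" "i \<le> n"
  shows "(relaxation_mat n \<eta> p *\<^sub>v x) $ i = (\<Sum>j\<le>n. relaxation_mat n \<eta> p $$ (i, j) * x $ j)"
proof -
  have "(relaxation_mat n \<eta> p *\<^sub>v x) $ i
      = (\<Sum>j\<in>{0..<n + 1}. relaxation_mat n \<eta> p $$ (i, j) * x $ j)"
    using assms by (auto simp: relaxation_mat_def scalar_prod_def intro!: sum.cong)
  also have "{0..<n + 1} = {..n}" by auto
  finally show ?thesis .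
qed

lemma relaxation_mat_mult_vec_0:
  assumes "x \<in> carrier_vec (n + 1)"
  shows "(relaxation_mat n \<eta> p *\<^sub>v x) $ 0
    = - inv_visc_sum n \<eta> * p 0 * x $ 0 + (\<Sum>i=1..n. inverse (\<eta> i) * sqrt (p 0 * p i) * x $ i)"
proof -
  have "{..n} = insert 0 {1..n}" by auto
  then show ?thesis
    unfolding relaxation_mat_mult_vec_index[OF assms le0]
    by (auto simp: relaxation_mat_def intro!: sum.cong)
qed

lemma relaxation_mat_mult_vec_pos:
  assumes "x \<in> carrier_vec (n + 1)" "i \<in> {1..n}"
  shows "(relaxation_mat n \<eta> p *\<^sub>v x) $ i
    = inverse (\<eta> i) * sqrt (p 0 * p i) * x $ 0 - p i * inverse (\<eta> i) * x $ i"
proof -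
  have "(\<Sum>j\<le>n. relaxation_mat n \<eta> p $$ (i, j) * x $ j)
      = (\<Sum>j\<in>{0, i}. relaxation_mat n \<eta> p $$ (i, j) * x $ j)"
    using assms by (intro sum.mono_neutral_right) (auto simp: relaxation_mat_def)
  then show ?thesis
    using assms relaxation_mat_mult_vec_index[OF assms(1), of i]
    by (auto simp: relaxation_mat_def)
qed

text \<open>
  The diagonal entry at \<open>0\<close> contains \<open>\<Sum>i. p 0 / \<eta> i\<close>. Its summand for each \<open>i \<ge> 1\<close>
  completes the terms in row and column \<open>i\<close> to a square; the summand for \<open>0\<close> is left over and
  makes the form definite.
\<close>

lemma relaxation_mat_quadratic_form:
  assumes x: "x \<in> carrier_vec (n + 1)" and p: "\<And>i. i \<le> n \<Longrightarrow> p i \<ge> 0"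
  shows "(\<Sum>i\<le>n. x $ i * (relaxation_mat n \<eta> p *\<^sub>v x) $ i)
    = - (inverse (\<eta> 0) * p 0 * (x $ 0)\<^sup>2
       + (\<Sum>i=1..n. inverse (\<eta> i) * (sqrt (p 0) * x $ 0 - sqrt (p i) * x $ i)\<^sup>2))"
proof -
  have split: "{..n} = insert 0 {1..n}" by auto
  have b: "inv_visc_sum n \<eta> = inverse (\<eta> 0) + (\<Sum>i=1..n. inverse (\<eta> i))"
    unfolding inv_visc_sum_def by (simp add: sum.atLeast_Suc_atMost)
  have term_eq: "inverse (\<eta> i) * (sqrt (p 0) * x $ 0 - sqrt (p i) * x $ i)\<^sup>2
     = inverse (\<eta> i) * p 0 * (x $ 0)\<^sup>2 - 2 * (inverse (\<eta> i) * sqrt (p 0 * p i) * x $ i * x $ 0)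
       + p i * inverse (\<eta> i) * (x $ i)\<^sup>2" if "i \<in> {1..n}" for i
    using p[of 0] p[of i] that
    by (simp add: power2_diff power_mult_distrib real_sqrt_mult algebra_simps)
  have "(\<Sum>i\<le>n. x $ i * (relaxation_mat n \<eta> p *\<^sub>v x) $ i)
    = x $ 0 * (- inv_visc_sum n \<eta> * p 0 * x $ 0
        + (\<Sum>i=1..n. inverse (\<eta> i) * sqrt (p 0 * p i) * x $ i))
      + (\<Sum>i=1..n. x $ i * (inverse (\<eta> i) * sqrt (p 0 * p i) * x $ 0 - p i * inverse (\<eta> i) * x $ i))"
    unfolding split by (simp add: relaxation_mat_mult_vec_0[OF x] relaxation_mat_mult_vec_pos[OF x])
  also have "\<dots> = - (inverse (\<eta> 0) * p 0 * (x $ 0)\<^sup>2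
       + (\<Sum>i=1..n. inverse (\<eta> i) * p 0 * (x $ 0)\<^sup>2 - 2 * (inverse (\<eta> i) * sqrt (p 0 * p i) * x $ i * x $ 0)
       + p i * inverse (\<eta> i) * (x $ i)\<^sup>2))"
    by (simp add: b sum.distrib sum_subtractf sum_distrib_left sum_distrib_right algebra_simps
        power2_eq_square sum_negf)
  finally show ?thesis using term_eq by simp
qed

lemma relaxation_rate_pos:
  assumes pos: "\<And>i. i \<le> n \<Longrightarrow> \<eta> i > 0" "\<And>i. i \<le> n \<Longrightarrow> p i > 0"
    and ev: "eigenvector (relaxation_mat n \<eta> p) x (- \<sigma>)"
  shows "\<sigma> > 0"
proof -
  have x: "x \<in> carrier_vec (n + 1)" and x0: "x \<noteq> 0\<^sub>v (n + 1)"
    and eq: "relaxation_mat n \<eta> p *\<^sub>v x = (- \<sigma>) \<cdot>\<^sub>v x"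
    using ev relaxation_mat_carrier[of n \<eta> p] unfolding eigenvector_def by auto
  define Q where "Q = inverse (\<eta> 0) * p 0 * (x $ 0)\<^sup>2
       + (\<Sum>i=1..n. inverse (\<eta> i) * (sqrt (p 0) * x $ 0 - sqrt (p i) * x $ i)\<^sup>2)"
  have "Q = \<sigma> * (\<Sum>i\<le>n. (x $ i)\<^sup>2)"
    using relaxation_mat_quadratic_form[OF x, of p \<eta>] pos(2) x
    by (simp add: eq Q_def less_imp_le sum_distrib_left power2_eq_square algebra_simps sum_negf)
  moreover have "Q > 0"
  proof (rule ccontr)
    assume neg: "\<not> Q > 0"
    let ?S = "\<Sum>i=1..n. inverse (\<eta> i) * (sqrt (p 0) * x $ 0 - sqrt (p i) * x $ i)\<^sup>2"
    have nn: "\<forall>i\<in>{1..n}. inverse (\<eta> i) * (sqrt (p 0) * x $ 0 - sqrt (p i) * x $ i)\<^sup>2 \<ge> 0"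
      using pos by (auto simp: less_imp_le)
    then have "?S \<ge> 0" by (intro sum_nonneg) auto
    moreover have "inverse (\<eta> 0) * p 0 * (x $ 0)\<^sup>2 \<ge> 0"
      using pos[of 0] by (auto simp: less_imp_le)
    ultimately have "inverse (\<eta> 0) * p 0 * (x $ 0)\<^sup>2 = 0" and s0: "?S = 0"
      using neg unfolding Q_def by linarith+
    then have z: "x $ 0 = 0" using pos[of 0] by auto
    have "x $ i = 0" if i: "i \<in> {1..n}" for i
    proof -
      have "inverse (\<eta> i) * (sqrt (p 0) * x $ 0 - sqrt (p i) * x $ i)\<^sup>2 = 0"
        using s0 nn i by (subst (asm) sum_nonneg_eq_0_iff) auto
      then show ?thesis using z pos[of i] i by auto
    qed
    with z have "x $ i = 0" if "i < n + 1" for i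
      using that by (cases i) auto
    then have "x = 0\<^sub>v (n + 1)" using x by (intro eq_vecI) auto
    with x0 show False by simp
  qed
  moreover have "(\<Sum>i\<le>n. (x $ i)\<^sup>2) \<ge> 0" by (intro sum_nonneg) auto
  ultimately show ?thesis
    by (metis mult_nonpos_nonneg not_le)
qed

text \<open>
  A square matrix with orthonormal columns has orthonormal rows, since a left inverse of a
  square matrix is also a right inverse.
\<close>

lemma orthonormal_vecs_complete:
  fixes v :: "nat \<Rightarrow> real vec"
  assumes v: "\<And>j. j \<le> n \<Longrightarrow> v j \<in> carrier_vec (n + 1)"
    and orth: "\<And>i j. i \<le> n \<Longrightarrow> j \<le> n \<Longrightarrow> v i \<bullet> v j = (if i = j then 1 else 0)"
    and ik: "i \<le> n" "k \<le> n"
  shows "(\<Sum>j\<le>n. v j $ i * v j $ k) = (if i = k then 1 else 0)"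
proof -
  define V where "V = mat (n + 1) (n + 1) (\<lambda>(i, j). v j $ i)"
  have V: "V \<in> carrier_mat (n + 1) (n + 1)" by (simp add: V_def)
  have col: "col V j = v j" if "j \<le> n" for j
    using v[OF that] that by (intro eq_vecI) (auto simp: V_def)
  have "transpose_mat V * V = 1\<^sub>m (n + 1)"
    using V by (intro eq_matI) (auto simp: col orth less_Suc_eq_le)
  then have "V * transpose_mat V = 1\<^sub>m (n + 1)"
    using mat_mult_left_right_inverse[of "transpose_mat V" "n + 1" V] V by auto
  then have "(V * transpose_mat V) $$ (i, k) = (if i = k then 1 else 0)"
    using ik by auto
  moreover have "(V * transpose_mat V) $$ (i, k) = (\<Sum>j\<le>n. v j $ i * v j $ k)"
    using ik V
    by (auto simp: scalar_prod_def V_def atLeast0LessThan lessThan_Suc_atMost intro!: sum.cong)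
  ultimately show ?thesis by simp
qed

lemma eigensystem_moment_0:
  assumes "orthonormal_eigensystem n (relaxation_mat n \<eta> p) \<sigma> v"
  shows "(\<Sum>j\<le>n. (v j $ 0)\<^sup>2) = 1"
  using orthonormal_vecs_complete[of n v 0 0] assms relaxation_mat_carrier[of n \<eta> p]
  by (auto simp: orthonormal_eigensystem_def eigenvector_def power2_eq_square)

text \<open>
  The entry at \<open>(0, 0)\<close> of the spectral decomposition \<open>A = - (\<Sum>j. \<sigma> j v\<^sub>j v\<^sub>j\<^sup>T)\<close>.
\<close>

lemma eigensystem_moment_1:
  assumes "orthonormal_eigensystem n (relaxation_mat n \<eta> p) \<sigma> v"
  shows "(\<Sum>j\<le>n. \<sigma> j * (v j $ 0)\<^sup>2) = inv_visc_sum n \<eta> * p 0"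
proof -
  let ?A = "relaxation_mat n \<eta> p"
  have v: "v j \<in> carrier_vec (n + 1)" and ev: "?A *\<^sub>v v j = (- \<sigma> j) \<cdot>\<^sub>v v j" if "j \<le> n" for j
    using assms that relaxation_mat_carrier[of n \<eta> p]
    by (auto simp: orthonormal_eigensystem_def eigenvector_def)
  have row: "- \<sigma> j * v j $ 0 = (\<Sum>k\<le>n. ?A $$ (0, k) * v j $ k)" if "j \<le> n" for j
    using relaxation_mat_mult_vec_index[OF v[OF that], of 0 \<eta> p] v[OF that] by (simp add: ev[OF that])
  have "(\<Sum>j\<le>n. \<sigma> j * (v j $ 0)\<^sup>2) = - (\<Sum>j\<le>n. (- \<sigma> j * v j $ 0) * v j $ 0)"
    by (simp add: power2_eq_square sum_negf mult.assoc)
  also have "\<dots> = - (\<Sum>j\<le>n. \<Sum>k\<le>n. ?A $$ (0, k) * (v j $ k * v j $ 0))"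
    using row by (simp add: sum_distrib_right mult.assoc)
  also have "\<dots> = - (\<Sum>k\<le>n. ?A $$ (0, k) * (\<Sum>j\<le>n. v j $ k * v j $ 0))"
    by (subst sum.swap) (simp add: sum_distrib_left)
  also have "\<dots> = - (\<Sum>k\<le>n. ?A $$ (0, k) * (if k = 0 then 1 else 0))"
    using orthonormal_vecs_complete[of n v _ 0] assms v
    by (intro arg_cong[of _ _ uminus] sum.cong) (auto simp: orthonormal_eigensystem_def)
  also have "\<dots> = - ?A $$ (0, 0)" by (simp add: if_distrib cong: if_cong)
  finally show ?thesis by (simp add: relaxation_mat_def)
qed

section \<open>The radial frequencies\<close>

text \<open>
  Below \<open>pi\<close> this follows from
  \<open>(y / 3 - sin y / (2 + cos y))' = (1 - cos y)\<^sup>2 / (3 (2 + cos y)\<^sup>2)\<close>; beyond \<open>pi\<close> the crude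
  bound \<open>y (2 + cos y) \<ge> y\<close> is enough, as \<open>sin y \<le> 0\<close> up to \<open>2 pi\<close> and \<open>y > 3\<close> after that.
\<close>

lemma three_sin_less:
  fixes y :: real
  assumes "y > 0"
  shows "3 * sin y < y * (2 + cos y)"
proof (cases "y < pi")
  case y_less: True
  let ?G = "\<lambda>y::real. y / 3 - sin y / (2 + cos y)"
  have pos: "2 + cos x > 0" for x :: real
    using cos_ge_minus_one[of x] by linarith
  have "?G 0 < ?G y"
  proof (rule DERIV_pos_imp_increasing_open[OF assms])
    fix x assume x: "0 < x" "x < y"
    have "(?G has_real_derivative
        1 / 3 - (cos x * (2 + cos x) - sin x * (- sin x)) / ((2 + cos x) * (2 + cos x))) (at x)"
      using pos[of x] by (auto intro!: derivative_eq_intros)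
    moreover have "1 / 3 - (cos x * (2 + cos x) - sin x * (- sin x)) / ((2 + cos x) * (2 + cos x))
        = (1 - cos x)\<^sup>2 / (3 * (2 + cos x)\<^sup>2)"
    proof -
      have s: "cos x * (2 + cos x) - sin x * (- sin x) = 2 * cos x + 1"
        using sin_cos_squared_add[of x] by (simp add: power2_eq_square algebra_simps)
      show ?thesis unfolding s using pos[of x]
        by (simp add: divide_simps) (simp add: power2_eq_square algebra_simps)
    qed
    moreover have "cos x < 1"
      using cos_monotone_0_pi[of 0 x] x y_less by auto
    ultimately show "\<exists>z. (?G has_real_derivative z) (at x) \<and> z > 0"
      using pos[of x] by (intro exI[of _ "(1 - cos x)\<^sup>2 / (3 * (2 + cos x)\<^sup>2)"]) auto
  next
    show "continuous_on {0..y} ?G"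
      using pos by (intro continuous_intros) (auto simp: less_imp_neq[symmetric])
  qed
  then show ?thesis using pos[of y] by (simp add: field_simps)
next
  case False
  have le: "y * 1 \<le> y * (2 + cos y)"
    using assms cos_ge_minus_one[of y] by (intro mult_left_mono) linarith+
  show ?thesis
  proof (cases "y < 2 * pi")
    case True
    then have "sin y \<le> 0" using False by (intro sin_le_zero) auto
    then show ?thesis using le assms by linarith
  next
    case False
    then show ?thesis using le sin_le_one[of y] pi_ge_two by linarith
  qed
qed

text \<open>
  This is the sign of the derivative in \<open>cot_quotient_decreasing\<close>. In terms of the double
  angle \<open>y = 2 x\<close> it says that \<open>y\<^sup>2 + y sin y - 4 + 4 cos y\<close> is positive; that function vanishes
  at \<open>0\<close> and its derivative is \<open>y (2 + cos y) - 3 sin y\<close>.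
\<close>

lemma two_sin_squared_less:
  fixes x :: real
  assumes "x > 0"
  shows "2 * (sin x)\<^sup>2 < x\<^sup>2 + x * sin x * cos x"
proof -
  let ?F = "\<lambda>y::real. y\<^sup>2 + y * sin y - 4 + 4 * cos y"
  have "?F 0 < ?F (2 * x)"
  proof (rule DERIV_pos_imp_increasing_open[of 0 "2 * x" ?F])
    fix y :: real assume "0 < y"
    then show "\<exists>z. (?F has_real_derivative z) (at y) \<and> z > 0"
      using three_sin_less[of y]
      by (intro exI[of _ "2 * y + (sin y + y * cos y) - 4 * sin y"])
        (auto intro!: derivative_eq_intros simp: algebra_simps)
  qed (use assms in \<open>auto intro!: continuous_intros\<close>)
  then show ?thesis
    unfolding sin_double cos_double_sin by (simp add: power2_eq_square algebra_simps)
qed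

lemma sin_nonzero_between_multiples_of_pi:
  assumes "(real k - 1) * pi < x" "x < real k * pi"
  shows "sin x \<noteq> 0"
proof
  assume "sin x = 0"
  then obtain i :: int where i: "x = of_int i * pi" using sin_zero_iff_int2 by auto
  with assms have "real k - 1 < of_int i" "of_int i < real k" by auto
  then have "int k - 1 < i" "i < int k" by linarith+
  then show False by simp
qed

lemma cot_quotient_decreasing:
  assumes "0 < x" "x < y" "(real k - 1) * pi < x" "y < real k * pi"
  shows "cos y / sin y / y - 1 / y\<^sup>2 < cos x / sin x / x - 1 / x\<^sup>2"
proof (rule DERIV_neg_imp_decreasing[OF assms(2)])
  fix z assume z: "x \<le> z" "z \<le> y"
  have s: "sin z \<noteq> 0"
    using assms z by (intro sin_nonzero_between_multiples_of_pi[of k]) auto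
  have z0: "z > 0" using assms z by auto
  let ?D = "((- sin z * sin z - cos z * cos z) / (sin z * sin z) * z - cos z / sin z) / (z * z)
     + 2 * z / (z\<^sup>2 * z\<^sup>2)"
  have deriv: "((\<lambda>z. cos z / sin z / z - 1 / z\<^sup>2) has_real_derivative ?D) (at z)"
    by (rule derivative_eq_intros refl | (use s z0 in simp; fail))+
  have D_eq: "?D = (2 * (sin z)\<^sup>2 - (z\<^sup>2 + z * sin z * cos z)) / (z ^ 3 * (sin z)\<^sup>2)"
  proof -
    have "- sin z * sin z - cos z * cos z = -1"
      using sin_cos_squared_add[of z] by (simp add: power2_eq_square)
    then show ?thesis using s z0 by (simp add: divide_simps power2_eq_square power3_eq_cube) 
        (simp add: algebra_simps)
  qed
  have "(2 * (sin z)\<^sup>2 - (z\<^sup>2 + z * sin z * cos z)) / (z ^ 3 * (sin z)\<^sup>2) < 0"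
    using two_sin_squared_less[OF z0] s z0 by (intro divide_neg_pos) auto
  with deriv show "\<exists>D. ((\<lambda>z. cos z / sin z / z - 1 / z\<^sup>2) has_real_derivative D) (at z) \<and> D < 0"
    unfolding D_eq by blast
qed

text \<open>
  Dividing \<open>char_fun l m x = 0\<close> by \<open>x\<^sup>2 sin x\<close> prescribes the value at \<open>x\<close> of the strictly decreasing
  function of \<open>cot_quotient_decreasing\<close>.
\<close>

lemma char_fun_zero_unique:
  assumes m: "m > 0" and k: "k \<ge> 1"
    and x: "(real k - 1) * pi < x" "x < real k * pi" "char_fun l m x = 0"
    and y: "(real k - 1) * pi < y" "y < real k * pi" "char_fun l m y = 0"
  shows "x = y"
proof -
  have pos: "z > 0" if "(real k - 1) * pi < z" for z
  proof -
    have "(real k - 1) * pi \<ge> 0" using k by simp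
    with that show ?thesis by linarith
  qed
  have val: "cos z / sin z / z - 1 / z\<^sup>2 = - (l + 2 * m) / (4 * m)"
    if "(real k - 1) * pi < z" "z < real k * pi" "char_fun l m z = 0" for z
    using that(3) m pos[OF that(1)] sin_nonzero_between_multiples_of_pi[OF that(1,2)]
    by (simp add: char_fun_def divide_simps power2_eq_square) (simp add: algebra_simps)
  show ?thesis
    using cot_quotient_decreasing[of x y k] cot_quotient_decreasing[of y x k]
      val[OF x] val[OF y] pos[OF x(1)] pos[OF y(1)] x(1,2) y(1,2)
    by (cases x y rule: linorder_cases) auto
qed

text \<open>
  For the root in \<open>(0, pi)\<close> the left endpoint gives no sign, as \<open>char_fun l m\<close> vanishes there
  to third order. Its derivative is \<open>x\<close> times a function with value \<open>0\<close> and slope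
  \<open>3 * l + 2 * m > 0\<close> at \<open>0\<close>.
\<close>

lemma char_fun_pos_near_zero:
  assumes "3 * l + 2 * m > 0"
  shows "\<exists>a. 0 < a \<and> a < pi \<and> char_fun l m a > 0"
proof -
  let ?c = "l + 2 * m"
  let ?g = "\<lambda>x::real. (2 * ?c - 4 * m) * sin x + ?c * x * cos x"
  have "(?g has_real_derivative 3 * l + 2 * m) (at 0)"
    by (auto intro!: derivative_eq_intros)
  from DERIV_pos_inc_right[OF this assms] obtain d
    where d: "d > 0" and g: "\<And>h. 0 < h \<Longrightarrow> h < d \<Longrightarrow> ?g h > 0"
    by auto
  define a where "a = min (d / 2) (pi / 2)"
  have a: "0 < a" "a < d" "a < pi" using d by (auto simp: a_def min_def)
  have "char_fun l m 0 < char_fun l m a"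
  proof (rule DERIV_pos_imp_increasing_open[OF a(1)])
    fix x assume x: "0 < x" "x < a"
    have "(char_fun l m has_real_derivative x * ?g x) (at x)"
      unfolding char_fun_def
      by (auto intro!: derivative_eq_intros) (simp add: power2_eq_square algebra_simps)
    moreover have "x * ?g x > 0" using g[of x] x a by simp
    ultimately show "\<exists>y. (char_fun l m has_real_derivative y) (at x) \<and> y > 0" by blast
  next
    show "continuous_on {0..a} (char_fun l m)"
      unfolding char_fun_def by (intro continuous_intros)
  qed
  moreover have "char_fun l m 0 = 0" by (simp add: char_fun_def)
  ultimately show ?thesis using a by auto
qed

lemma char_fun_zero_exists:
  assumes m: "m > 0" and p: "3 * l + 2 * m > 0" and k: "k \<ge> 1"
  shows "\<exists>x. (real k - 1) * pi < x \<and> x < real k * pi \<and> char_fun l m x = 0"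
proof -
  \<comment> \<open>The factor \<open>(-1) ^ k\<close> makes the value at the right endpoint positive.\<close>
  let ?g = "\<lambda>x. (-1) ^ k * char_fun l m x"
  have at_pi: "char_fun l m (real j * pi) = 4 * m * (real j * pi) * (-1) ^ j" for j
    by (simp add: char_fun_def)
  have "\<exists>a. (real k - 1) * pi \<le> a \<and> a < real k * pi \<and> ?g a < 0"
  proof (cases "k = 1")
    case True
    then show ?thesis using char_fun_pos_near_zero[OF p] by (auto intro: less_imp_le)
  next
    case False
    with k obtain j where j: "k = Suc j" "j > 0" by (cases k) auto
    have "?g (real j * pi) < 0"
      unfolding at_pi using j m by (auto simp: mult_less_0_iff power_mult_distrib[symmetric] zero_less_mult_iff)
    then show ?thesis using j by (intro exI[of _ "real j * pi"]) auto
  qed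
  then obtain a where a: "(real k - 1) * pi \<le> a" "a < real k * pi" "?g a < 0" by blast
  have e: "?g (real k * pi) > 0"
    unfolding at_pi using k m by (simp add: power_mult_distrib[symmetric])
  have "\<exists>x\<ge>a. x \<le> real k * pi \<and> ?g x = 0"
    using a e by (intro IVT') (auto simp: char_fun_def intro!: continuous_intros)
  then obtain x where x: "a \<le> x" "x \<le> real k * pi" "?g x = 0" by blast
  then have "x \<noteq> a" "x \<noteq> real k * pi" using a e by auto
  with x a show ?thesis by (intro exI[of _ x]) auto
qed

lemma char_root_interval:
  assumes "m > 0" "3 * l + 2 * m > 0" "k \<ge> 1"
  shows "(real k - 1) * pi < char_root l m k" "char_root l m k < real k * pi"
proof -
  have "\<exists>!x. (real k - 1) * pi < x \<and> x < real k * pi \<and> char_fun l m x = 0"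
    using char_fun_zero_exists[OF assms] char_fun_zero_unique[OF assms(1,3)] by blast
  from theI'[OF this] show "(real k - 1) * pi < char_root l m k" "char_root l m k < real k * pi"
    unfolding char_root_def by auto
qed

lemma char_root_pos:
  assumes "m > 0" "3 * l + 2 * m > 0" "k \<ge> 1"
  shows "char_root l m k > 0"
proof -
  have "(real k - 1) * pi \<ge> 0" using assms by simp
  with char_root_interval(1)[OF assms] show ?thesis by linarith
qed

lemma char_root_less:
  assumes "m > 0" "3 * l + 2 * m > 0" "j \<ge> 1" "j < k"
  shows "char_root l m j < char_root l m k"
proof -
  have "real j * pi \<le> (real k - 1) * pi" using assms by (intro mult_right_mono) auto
  then show ?thesis
    using char_root_interval(2)[OF assms(1,2,3)] char_root_interval(1)[OF assms(1,2), of k] assms(3,4)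
    by linarith
qed

lemma char_root_scale:
  assumes "s \<noteq> 0"
  shows "char_root (s * l) (s * m) k = char_root l m k"
proof -
  have "char_fun (s * l) (s * m) x = s * char_fun l m x" for x
    by (simp add: char_fun_def algebra_simps)
  then show ?thesis using assms by (simp add: char_root_def)
qed

section \<open>Cluster polynomials\<close>

definition node_poly :: "'i set \<Rightarrow> ('i \<Rightarrow> real) \<Rightarrow> real poly" where
  "node_poly J b = (\<Prod>j\<in>J. [:b j, 1:])"

text \<open>
  The numerator of the partial fraction \<open>\<Sum>i\<in>J. w i / (z + b i)\<close> over the common denominator
  \<open>node_poly J b\<close>.
\<close>

definition pole_sum :: "'i set \<Rightarrow> ('i \<Rightarrow> real) \<Rightarrow> ('i \<Rightarrow> real) \<Rightarrow> real poly" where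
  "pole_sum J b w = (\<Sum>i\<in>J. Polynomial.smult (w i) (node_poly (J - {i}) b))"

lemma degree_node_poly: "degree (node_poly J b) = card J"
  unfolding node_poly_def by (subst degree_prod_sum_eq) auto

lemma lead_coeff_node_poly: "lead_coeff (node_poly J b) = 1"
  unfolding node_poly_def by (simp add: lead_coeff_prod)

lemma degree_pole_sum_le:
  assumes "finite J"
  shows "degree (pole_sum J b w) \<le> card J"
  unfolding pole_sum_def
  by (intro degree_sum_le[OF assms] order.trans[OF degree_smult_le])
    (simp add: degree_node_poly assms card_Diff1_le)

lemma poly_pole_sum_0_pos:
  assumes J: "finite J" and b: "\<And>i. i \<in> J \<Longrightarrow> b i > 0" and w: "\<And>i. i \<in> J \<Longrightarrow> w i \<ge> 0"
    and s: "sum w J > 0"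
  shows "poly (pole_sum J b w) 0 > 0"
proof -
  obtain i where i: "i \<in> J" "w i > 0"
    using s w by (metis less_irrefl order_le_less sum.neutral)
  have p: "(\<Prod>j\<in>J - {i}. b j) > 0" for i
    using b by (intro prod_pos) auto
  have "poly (pole_sum J b w) 0 = (\<Sum>i\<in>J. w i * (\<Prod>j\<in>J - {i}. b j))"
    by (simp add: pole_sum_def node_poly_def poly_sum poly_prod)
  also have "\<dots> > 0"
    using i J p w by (intro sum_pos2[of J i]) (auto simp: less_imp_le)
  finally show ?thesis .
qed

lemma poly_pole_sum_at_node:
  assumes J: "finite J" and i: "i \<in> J"
  shows "poly (pole_sum J b w) (- b i) = w i * (\<Prod>j\<in>J - {i}. b j - b i)"
proof -
  have "poly (pole_sum J b w) (- b i) = (\<Sum>k\<in>J. w k * (\<Prod>j\<in>J - {k}. b j - b i))"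
    by (simp add: pole_sum_def node_poly_def poly_sum poly_prod)
  also have "\<dots> = (\<Sum>k\<in>{i}. w k * (\<Prod>j\<in>J - {k}. b j - b i))"
    using J i by (intro sum.mono_neutral_right) auto
  finally show ?thesis by simp
qed

text \<open>
  At \<open>z = - b i\<close> only the summand with index \<open>i\<close> survives, and its factor is nonzero because
  the nodes are distinct: up to this factor, the weights are residues.
\<close>

lemma pole_sum_proportional_imp_weights:
  assumes J: "finite J" and inj: "inj_on b J"
    and eq: "pole_sum J b w = Polynomial.smult k (pole_sum J b w')" and i: "i \<in> J"
  shows "w i = k * w' i"
proof -
  have "(\<Prod>j\<in>J - {i}. b j - b i) \<noteq> 0"
    using J inj i by (auto simp: inj_on_def)
  moreover have "w i * (\<Prod>j\<in>J - {i}. b j - b i) = k * w' i * (\<Prod>j\<in>J - {i}. b j - b i)"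
    using arg_cong[OF eq, of "\<lambda>p. poly p (- b i)"] poly_pole_sum_at_node[OF J i] by simp
  ultimately show ?thesis by simp
qed

lemma node_poly_roots:
  assumes "finite J"
  shows "{x. poly (node_poly J b) x = 0} = (\<lambda>j. - b j) ` J"
proof -
  have "b j + x = 0 \<longleftrightarrow> x = - b j" for j x by auto
  then show ?thesis using assms by (auto simp: node_poly_def poly_prod)
qed

text \<open>A finite set of reals has only one increasing enumeration.\<close>

lemma strict_mono_same_image:
  fixes b b' :: "nat \<Rightarrow> real"
  assumes "strict_mono_on {1..N} b" "strict_mono_on {1..N} b'" and im: "b ` {1..N} = b' ` {1..N}"
    and j: "j \<in> {1..N}"
  shows "b j = b' j"
proof -
  have srt: "sorted (map f [1..<Suc N])" "distinct (map f [1..<Suc N])"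
    if "strict_mono_on {1..N} f" for f :: "nat \<Rightarrow> real"
  proof -
    have "sorted_wrt (<) (map f [1..<Suc N])"
      using that unfolding sorted_wrt_map
      by (intro sorted_wrt_mono_rel[OF _ sorted_wrt_upt]) (auto simp: strict_mono_on_def)
    then show "sorted (map f [1..<Suc N])" "distinct (map f [1..<Suc N])"
      by (auto simp: strict_sorted_iff)
  qed
  have "set [1..<Suc N] = {1..N}" by auto
  then have "map b [1..<Suc N] = map b' [1..<Suc N]"
    using srt[OF assms(1)] srt[OF assms(2)] im
    by (intro sorted_distinct_set_unique) (auto simp del: upt_Suc)
  then show ?thesis using j by (auto simp del: upt_Suc)
qed

text \<open>
  With \<open>c = \<Sum>i. a i / b i\<close>, each summand of \<open>c - \<Sum>i. a i / (z + b i)\<close> becomes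
  \<open>a i / b i - a i / (z + b i) = z (a i / b i) / (z + b i)\<close>, which contributes a factor \<open>z\<close>.
\<close>

lemma cluster_poly_factor:
  fixes n :: nat and a b :: "nat \<Rightarrow> real"
  defines "J \<equiv> {1..2 * n + 2}"
  assumes b: "\<And>i. i \<in> J \<Longrightarrow> b i \<noteq> 0" and c: "c = (\<Sum>i\<in>J. a i / b i)"
  shows "cluster_poly n R c r a b
    = pCons 0 (pCons 0 (Polynomial.smult (R\<^sup>2 / r\<^sup>2) (node_poly J b)) + pole_sum J b (\<lambda>i. a i / b i))"
proof -
  have "Polynomial.smult c (node_poly J b)
      - (\<Sum>i\<in>J. Polynomial.smult (a i) (node_poly (J - {i}) b))
    = (\<Sum>i\<in>J. Polynomial.smult (a i / b i) (node_poly J b)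
        - Polynomial.smult (a i) (node_poly (J - {i}) b))"
    unfolding c by (simp add: smult_sum sum_subtractf)
  also have "\<dots> = (\<Sum>i\<in>J. [:0, 1:] * Polynomial.smult (a i / b i) (node_poly (J - {i}) b))"
  proof (rule sum.cong[OF refl])
    fix i assume i: "i \<in> J"
    have "node_poly J b = [:b i, 1:] * node_poly (J - {i}) b"
      unfolding node_poly_def by (rule prod.remove) (use i in \<open>auto simp: J_def\<close>)
    then show "Polynomial.smult (a i / b i) (node_poly J b)
        - Polynomial.smult (a i) (node_poly (J - {i}) b)
      = [:0, 1:] * Polynomial.smult (a i / b i) (node_poly (J - {i}) b)"
      using b[OF i] by (simp add: smult_add_right)
  qed
  also have "\<dots> = [:0, 1:] * pole_sum J b (\<lambda>i. a i / b i)"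
    by (simp only: pole_sum_def sum_distrib_left)
  finally have split: "Polynomial.smult c (node_poly J b)
      - (\<Sum>i\<in>J. Polynomial.smult (a i) (node_poly (J - {i}) b))
    = pCons 0 (pole_sum J b (\<lambda>i. a i / b i))" by simp
  have "cluster_poly n R c r a b
    = (Polynomial.smult c (node_poly J b) - (\<Sum>i\<in>J. Polynomial.smult (a i) (node_poly (J - {i}) b)))
      + pCons 0 (pCons 0 (Polynomial.smult (R\<^sup>2 / r\<^sup>2) (node_poly J b)))"
    unfolding cluster_poly_def J_def[symmetric] node_poly_def[symmetric] by simp
  then show ?thesis unfolding split by (simp add: add.commute)
qed

lemma lead_coeff_cluster_shape:
  assumes J: "finite J" and s: "s \<noteq> 0"
  shows "lead_coeff (pCons 0 (pCons 0 (Polynomial.smult s (node_poly J b)) + pole_sum J b w)) = s"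
proof -
  let ?B = "pCons 0 (Polynomial.smult s (node_poly J b))"
  have B0: "node_poly J b \<noteq> 0" using lead_coeff_node_poly[of J b] by auto
  have "degree (pole_sum J b w) < degree ?B"
    using degree_pole_sum_le[OF J, of b w] s B0 by (simp add: degree_node_poly)
  then have "lead_coeff (?B + pole_sum J b w) = s"
    using s B0 lead_coeff_node_poly[of J b] lead_coeff_add_le[of "pole_sum J b w" ?B]
    by (simp add: add.commute)
  moreover from this have "?B + pole_sum J b w \<noteq> 0" using s by (metis leading_coeff_0_iff)
  ultimately show ?thesis by simp
qed

text \<open>
  Over the complex numbers a polynomial is its leading coefficient times the product of its
  linear factors.
\<close>

lemma proots_eq_imp_proportional:
  fixes p q :: "real poly"
  assumes "proots (map_poly complex_of_real p) = proots (map_poly complex_of_real q)"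
  shows "Polynomial.smult (lead_coeff q) p = Polynomial.smult (lead_coeff p) q"
proof -
  interpret hom: map_poly_inj_idom_hom complex_of_real ..
  let ?p = "map_poly complex_of_real p" and ?q = "map_poly complex_of_real q"
  define M where "M = (\<Prod>x\<in>#proots ?p. [:-x, 1:])"
  have "?p = Polynomial.smult (lead_coeff ?p) M" "?q = Polynomial.smult (lead_coeff ?q) M"
    using complex_poly_decompose_multiset[of ?p] complex_poly_decompose_multiset[of ?q] assms
    by (simp_all add: M_def)
  then have "Polynomial.smult (lead_coeff ?q) ?p = Polynomial.smult (lead_coeff ?p) ?q"
    by (metis mult.commute smult_smult)
  then have "map_poly complex_of_real (Polynomial.smult (lead_coeff q) p)
      = map_poly complex_of_real (Polynomial.smult (lead_coeff p) q)"
    by (simp add: of_real_hom.map_poly_hom_smult)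
  then show ?thesis by (rule hom.injectivity)
qed

text \<open>
  The two equations at \<open>0\<close> produce one proportionality factor for both \<open>t1\<close> and \<open>t2\<close>, because
  the factor is the quotient of the values of \<open>E\<close> and \<open>E'\<close> at \<open>0\<close>. The difference of the
  equations then carries it over to \<open>E\<close> and \<open>E'\<close> themselves.
\<close>

lemma two_normalised_clusters_rigid:
  fixes B B' E E' :: "real poly"
  assumes eq1: "pCons 0 B + Polynomial.smult t1 E = pCons 0 B' + Polynomial.smult t1' E'"
    and eq2: "pCons 0 B + Polynomial.smult t2 E = pCons 0 B' + Polynomial.smult t2' E'"
    and t: "t1 \<noteq> t2" and E': "poly E' 0 \<noteq> 0"
  obtains k where "E = Polynomial.smult k E'" "B = B'" "t1' = k * t1"
proof
  define k where "k = poly E 0 / poly E' 0"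
  have ev: "t1 * poly E 0 = t1' * poly E' 0" "t2 * poly E 0 = t2' * poly E' 0"
    using arg_cong[OF eq1, of "\<lambda>p. poly p 0"] arg_cong[OF eq2, of "\<lambda>p. poly p 0"] by auto
  then have t': "t1' = k * t1" "t2' = k * t2"
    using E' by (auto simp: k_def field_simps)
  show "t1' = k * t1" by (fact t')
  have "Polynomial.smult (t1 - t2) E = Polynomial.smult (t1' - t2') E'"
    using arg_cong2[OF eq1 eq2, of "(-)"] by (simp add: smult_diff_left)
  also have "\<dots> = Polynomial.smult (t1 - t2) (Polynomial.smult k E')"
    by (simp add: t' algebra_simps)
  finally show E: "E = Polynomial.smult k E'"
    using t by (metis right_minus_eq smult_cancel)
  show "B = B'"
    using eq1 by (simp add: E t' mult.commute)
qed

section \<open>The invariants carried by the residues\<close>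

lemma sum_two_blocks:
  fixes g :: "nat \<Rightarrow> 'a :: comm_monoid_add"
  shows "(\<Sum>i=1..n + 1. g i) = (\<Sum>j\<le>n. g (j + 1))"
    and "(\<Sum>i=n + 2..2 * n + 2. g i) = (\<Sum>j\<le>n. g (j + (n + 2)))"
    and "(\<Sum>i=1..2 * n + 2. g i) = (\<Sum>j\<le>n. g (j + 1)) + (\<Sum>j\<le>n. g (j + (n + 2)))"
proof -
  show 1: "(\<Sum>i=1..n + 1. g i) = (\<Sum>j\<le>n. g (j + 1))"
    by (rule sum.reindex_bij_witness[of _ "\<lambda>j. j + 1" "\<lambda>i. i - 1"]) auto
  show 2: "(\<Sum>i=n + 2..2 * n + 2. g i) = (\<Sum>j\<le>n. g (j + (n + 2)))"
    using sum.shift_bounds_cl_nat_ivl[of g 0 "n + 2" n] by (simp add: atLeast0AtMost mult_2)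
  have "{1..2 * n + 2} = {1..n + 1} \<union> {n + 2..2 * n + 2}" by auto
  then show "(\<Sum>i=1..2 * n + 2. g i) = (\<Sum>j\<le>n. g (j + 1)) + (\<Sum>j\<le>n. g (j + (n + 2)))"
    unfolding 1[symmetric] 2[symmetric] by (simp add: sum.union_disjoint)
qed

text \<open>
  The theorem compares two models, so their common properties are stated in a locale that is
  interpreted twice.
\<close>

locale relaxation_spectrum =
  fixes n :: nat and \<eta> lam \<mu> \<tau> \<kappa> :: "nat \<Rightarrow> real" and v q :: "nat \<Rightarrow> real vec"
  assumes model: "burgers_model n \<eta> lam \<mu>"
    and spectrum: "ordered_spectrum n \<eta> lam \<mu> \<tau> v \<kappa> q"
begin

abbreviation a where "a \<equiv> alpha n lam \<mu> \<tau> v \<kappa> q"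
abbreviation b where "b \<equiv> beta n \<tau> \<kappa>"
abbreviation wave_modulus where "wave_modulus \<equiv> lam 0 + 2 * \<mu> 0"
abbreviation root where "root \<equiv> char_root (lam 0) (\<mu> 0)"

lemma parameters_pos: "i \<le> n \<Longrightarrow> \<eta> i > 0" "i \<le> n \<Longrightarrow> \<mu> i > 0" "i \<le> n \<Longrightarrow> 3 * lam i + 2 * \<mu> i > 0"
  using model by (auto simp: burgers_model_def)

lemma shear_system: "orthonormal_eigensystem n (relaxation_mat n \<eta> (\<lambda>i. 2 * \<mu> i)) \<tau> v"
  using spectrum by (simp add: ordered_spectrum_def L1S_eq_relaxation_mat)

lemma bulk_system:
  "orthonormal_eigensystem n (relaxation_mat n \<eta> (\<lambda>i. 3 * lam i + 2 * \<mu> i)) \<kappa> q"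
  using spectrum by (simp add: ordered_spectrum_def L0S_eq_relaxation_mat)

lemma rates_pos:
  assumes "j \<le> n"
  shows "\<tau> j > 0" "\<kappa> j > 0"
proof -
  have ev: "eigenvector (relaxation_mat n \<eta> (\<lambda>i. 2 * \<mu> i)) (v j) (- \<tau> j)"
    "eigenvector (relaxation_mat n \<eta> (\<lambda>i. 3 * lam i + 2 * \<mu> i)) (q j) (- \<kappa> j)"
    using shear_system bulk_system assms by (simp_all add: orthonormal_eigensystem_def)
  show "\<tau> j > 0"
    by (rule relaxation_rate_pos[OF _ _ ev(1)]) (simp_all add: parameters_pos)
  show "\<kappa> j > 0"
    by (rule relaxation_rate_pos[OF _ _ ev(2)]) (simp_all add: parameters_pos)
qed

lemma b_pos:
  assumes "i \<in> {1..2 * n + 2}" shows "b i > 0"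
proof (cases "i \<le> n + 1")
  case True
  then show ?thesis using rates_pos(1)[of "i - 1"] by (simp add: beta_def)
next
  case False
  then show ?thesis using rates_pos(2)[of "i - (n + 2)"] assms by (simp add: beta_def)
qed

lemma strict_mono_b: "strict_mono_on {1..2 * n + 2} b"
proof (rule strict_mono_onI)
  fix i j assume ij: "i \<in> {1..2 * n + 2}" "j \<in> {1..2 * n + 2}" "i < j"
  have \<tau>: "\<tau> r < \<tau> s" and \<kappa>: "\<kappa> r < \<kappa> s" if "r < s" "s \<le> n" for r s
    using spectrum that by (auto simp: ordered_spectrum_def strict_mono_on_def)
  have le: "\<tau> r \<le> \<tau> n" "\<kappa> 0 \<le> \<kappa> r" if "r \<le> n" for r
    using \<tau>[of r n] \<kappa>[of 0 r] that by (cases "r = n"; cases "r = 0"; auto)+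
  have gap: "\<tau> n < \<kappa> 0" using spectrum by (simp add: ordered_spectrum_def)
  consider "j \<le> n + 1" | "i \<le> n + 1" "\<not> j \<le> n + 1" | "\<not> i \<le> n + 1" using ij by linarith
  then show "b i < b j"
  proof cases
    case 1
    then show ?thesis using ij \<tau>[of "i - 1" "j - 1"] by (auto simp: beta_def)
  next
    case 2
    have "\<tau> (i - 1) \<le> \<tau> n" "\<kappa> 0 \<le> \<kappa> (j - (n + 2))"
      using 2 ij by (auto intro!: le simp del: One_nat_def)
    then show ?thesis using 2 gap by (simp add: beta_def)
  next
    case 3
    then show ?thesis using ij \<kappa>[of "i - (n + 2)" "j - (n + 2)"] by (auto simp: beta_def)
  qed
qed

lemma a_nonneg:
  assumes "i \<in> {1..2 * n + 2}" shows "a i \<ge> 0"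
proof (cases "i \<le> n + 1")
  case True
  then have "\<tau> (i - 1) > 0" by (intro rates_pos) auto
  then show ?thesis using True parameters_pos(2)[of 0] by (simp add: alpha_def)
next
  case False
  have "lam 0 + 2 / 3 * \<mu> 0 > 0" using parameters_pos(3)[of 0] by simp
  moreover have "\<kappa> (i - (n + 2)) > 0" using assms by (intro rates_pos) auto
  ultimately show ?thesis using False by (simp add: alpha_def)
qed

text \<open>
  The rates cancel, and the components with index \<open>0\<close> of an orthonormal basis have squares with
  sum \<open>1\<close>. This is the relation that makes every cluster contain the eigenvalue \<open>0\<close>.
\<close>

lemma sum_a_over_b: "(\<Sum>i=1..2 * n + 2. a i / b i) = wave_modulus"
proof -
  have "(\<Sum>i=1..2 * n + 2. a i / b i)
    = (\<Sum>j\<le>n. 4 / 3 * \<mu> 0 * (v j $ 0)\<^sup>2) + (\<Sum>j\<le>n. (lam 0 + 2 / 3 * \<mu> 0) * (q j $ 0)\<^sup>2)"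
    unfolding sum_two_blocks(3)
    by (intro arg_cong2[of _ _ _ _ "(+)"] sum.cong refl)
      (auto simp: alpha_def beta_def dest: rates_pos)
  also have "\<dots> = 4 / 3 * \<mu> 0 + (lam 0 + 2 / 3 * \<mu> 0)"
    by (simp only: eigensystem_moment_0[OF shear_system] eigensystem_moment_0[OF bulk_system]
        flip: sum_distrib_left) simp
  finally show ?thesis by simp
qed

lemma wave_modulus_pos: "wave_modulus > 0"
  using parameters_pos(2,3)[of 0] by simp

lemma sum_a_shear: "(\<Sum>i=1..n + 1. a i) = 8 / 3 * inv_visc_sum n \<eta> * (\<mu> 0)\<^sup>2"
proof -
  have "(\<Sum>i=1..n + 1. a i) = (\<Sum>j\<le>n. 4 / 3 * \<mu> 0 * (\<tau> j * (v j $ 0)\<^sup>2))"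
    unfolding sum_two_blocks(1) by (intro sum.cong) (auto simp: alpha_def)
  also have "\<dots> = 4 / 3 * \<mu> 0 * (inv_visc_sum n \<eta> * (2 * \<mu> 0))"
    by (simp only: eigensystem_moment_1[OF shear_system] flip: sum_distrib_left)
  finally show ?thesis by (simp add: power2_eq_square)
qed

lemma sum_a_bulk:
  "(\<Sum>i=n + 2..2 * n + 2. a i) = inv_visc_sum n \<eta> * (3 * lam 0 + 2 * \<mu> 0)\<^sup>2 / 3"
proof -
  have "(\<Sum>i=n + 2..2 * n + 2. a i)
      = (\<Sum>j\<le>n. (lam 0 + 2 / 3 * \<mu> 0) * (\<kappa> j * (q j $ 0)\<^sup>2))"
    unfolding sum_two_blocks(2) by (intro sum.cong) (auto simp: alpha_def)
  also have "\<dots> = (lam 0 + 2 / 3 * \<mu> 0) * (inv_visc_sum n \<eta> * (3 * lam 0 + 2 * \<mu> 0))"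
    by (simp only: eigensystem_moment_1[OF bulk_system] flip: sum_distrib_left)
  finally show ?thesis by (simp add: power2_eq_square algebra_simps)
qed

lemma inv_visc_sum_pos: "inv_visc_sum n \<eta> > 0"
  unfolding inv_visc_sum_def using parameters_pos(1) by (intro sum_pos) auto

lemma root_pos: "k \<ge> 1 \<Longrightarrow> root k > 0"
  using char_root_pos parameters_pos by simp

lemma root_neq: "j \<ge> 1 \<Longrightarrow> k \<ge> 1 \<Longrightarrow> j \<noteq> k \<Longrightarrow> root j \<noteq> root k"
  using char_root_less[of "\<mu> 0" "lam 0" j k] char_root_less[of "\<mu> 0" "lam 0" k j]
    parameters_pos(2,3)[of 0]
  by (cases j k rule: linorder_cases) auto

lemma cluster_poly_eq:
  "cluster_poly n R wave_modulus r a b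
    = pCons 0 (pCons 0 (Polynomial.smult (R\<^sup>2 / r\<^sup>2) (node_poly {1..2 * n + 2} b))
        + pole_sum {1..2 * n + 2} b (\<lambda>i. a i / b i))"
  by (rule cluster_poly_factor) (use b_pos sum_a_over_b in force)+

lemma lead_coeff_cluster:
  assumes "R > 0" "k \<ge> 1"
  shows "lead_coeff (cluster_poly n R wave_modulus (root k) a b) = R\<^sup>2 / (root k)\<^sup>2"
  unfolding cluster_poly_eq
  by (rule lead_coeff_cluster_shape) (use root_pos assms in force)+

text \<open>
  Made monic, the polynomial depends on the root only through the factor in front of the pole sum.
\<close>

lemma normalised_cluster_poly:
  assumes "R > 0" "k \<ge> 1"
  shows "Polynomial.smult ((root k)\<^sup>2 / R\<^sup>2) (cluster_poly n R wave_modulus (root k) a b)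
    = pCons 0 (pCons 0 (node_poly {1..2 * n + 2} b)
        + Polynomial.smult ((root k)\<^sup>2 / R\<^sup>2) (pole_sum {1..2 * n + 2} b (\<lambda>i. a i / b i)))"
  unfolding cluster_poly_eq using root_pos[OF assms(2)] assms by (simp add: smult_add_right)

end

section \<open>Two clusters determine the model's residues and poles\<close>

lemma cluster_eq_imp_normalised_eq:
  assumes "relaxation_spectrum n \<eta> lam \<mu> \<tau> \<kappa> v q"
    and "relaxation_spectrum n \<eta>' lam' \<mu>' \<tau>' \<kappa>' v' q'"
    and R: "R > 0" and k: "k \<ge> 1"
    and eq: "cluster n R lam \<mu> \<tau> v \<kappa> q k = cluster n R lam' \<mu>' \<tau>' v' \<kappa>' q' k"
  defines "J \<equiv> {1..2 * n + 2}"
    and "a \<equiv> alpha n lam \<mu> \<tau> v \<kappa> q" and "a' \<equiv> alpha n lam' \<mu>' \<tau>' v' \<kappa>' q'"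
    and "b \<equiv> beta n \<tau> \<kappa>" and "b' \<equiv> beta n \<tau>' \<kappa>'"
  shows "pCons 0 (node_poly J b)
      + Polynomial.smult ((char_root (lam 0) (\<mu> 0) k)\<^sup>2 / R\<^sup>2) (pole_sum J b (\<lambda>i. a i / b i))
    = pCons 0 (node_poly J b')
      + Polynomial.smult ((char_root (lam' 0) (\<mu>' 0) k)\<^sup>2 / R\<^sup>2) (pole_sum J b' (\<lambda>i. a' i / b' i))"
proof -
  interpret M: relaxation_spectrum n \<eta> lam \<mu> \<tau> \<kappa> v q by fact
  interpret M': relaxation_spectrum n \<eta>' lam' \<mu>' \<tau>' \<kappa>' v' q' by fact
  let ?P = "cluster_poly n R M.wave_modulus (M.root k) M.a M.b"
  let ?P' = "cluster_poly n R M'.wave_modulus (M'.root k) M'.a M'.b"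
  let ?s = "R\<^sup>2 / (M.root k)\<^sup>2" and ?s' = "R\<^sup>2 / (M'.root k)\<^sup>2"
  have "Polynomial.smult ?s' ?P = Polynomial.smult ?s ?P'"
    using proots_eq_imp_proportional[of ?P ?P'] eq
    by (simp add: cluster_def M.lead_coeff_cluster[OF R k] M'.lead_coeff_cluster[OF R k])
  then have "Polynomial.smult (1 / (?s * ?s')) (Polynomial.smult ?s' ?P)
      = Polynomial.smult (1 / (?s * ?s')) (Polynomial.smult ?s ?P')"
    by (rule arg_cong)
  then have "Polynomial.smult (1 / (?s * ?s') * ?s') ?P = Polynomial.smult (1 / (?s * ?s') * ?s) ?P'"
    by (simp only: smult_smult)
  moreover have "1 / (?s * ?s') * ?s' = (M.root k)\<^sup>2 / R\<^sup>2"
    "1 / (?s * ?s') * ?s = (M'.root k)\<^sup>2 / R\<^sup>2"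
    using M.root_pos[OF k] M'.root_pos[OF k] R by (simp_all add: field_simps)
  ultimately have "Polynomial.smult ((M.root k)\<^sup>2 / R\<^sup>2) ?P
      = Polynomial.smult ((M'.root k)\<^sup>2 / R\<^sup>2) ?P'"
    by (simp only:)
  then show ?thesis
    unfolding M.normalised_cluster_poly[OF R k] M'.normalised_cluster_poly[OF R k]
    by (simp add: J_def a_def b_def a'_def b'_def)
qed

text \<open>
  The quotient of the bulk and shear sums of the residues is, up to a constant,
  \<open>((3 * lam 0 + 2 * \<mu> 0) / \<mu> 0)\<^sup>2\<close>: both \<open>inv_visc_sum\<close> and the factor \<open>s\<close> drop out. As the base
  is positive, it determines \<open>lam 0 / \<mu> 0\<close>, and by homogeneity the roots depend on
  that ratio only.
\<close>

lemma proportional_residues_imp_same_roots: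
  assumes "relaxation_spectrum n \<eta> lam \<mu> \<tau> \<kappa> v q"
    and "relaxation_spectrum n \<eta>' lam' \<mu>' \<tau>' \<kappa>' v' q'"
    and residues: "\<And>i. i \<in> {1..2 * n + 2} \<Longrightarrow>
      alpha n lam \<mu> \<tau> v \<kappa> q i = s * alpha n lam' \<mu>' \<tau>' v' \<kappa>' q' i"
  shows "char_root (lam 0) (\<mu> 0) = char_root (lam' 0) (\<mu>' 0)"
proof -
  interpret M: relaxation_spectrum n \<eta> lam \<mu> \<tau> \<kappa> v q by fact
  interpret M': relaxation_spectrum n \<eta>' lam' \<mu>' \<tau>' \<kappa>' v' q' by fact
  let ?b = "inv_visc_sum n \<eta>" and ?b' = "inv_visc_sum n \<eta>'"
  let ?K = "3 * lam 0 + 2 * \<mu> 0" and ?K' = "3 * lam' 0 + 2 * \<mu>' 0"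
  note pos = M.parameters_pos(2,3)[of 0, simplified] M'.parameters_pos(2,3)[of 0, simplified]
    M.inv_visc_sum_pos M'.inv_visc_sum_pos
  have "(\<Sum>i=1..n + 1. M.a i) = s * (\<Sum>i=1..n + 1. M'.a i)"
    "(\<Sum>i=n + 2..2 * n + 2. M.a i) = s * (\<Sum>i=n + 2..2 * n + 2. M'.a i)"
    unfolding sum_distrib_left by (intro sum.cong refl residues; simp)+
  then have shear: "?b * (\<mu> 0)\<^sup>2 = s * ?b' * (\<mu>' 0)\<^sup>2" and bulk: "?b * ?K\<^sup>2 = s * ?b' * ?K'\<^sup>2"
    unfolding M.sum_a_shear M'.sum_a_shear M.sum_a_bulk M'.sum_a_bulk by simp_all
  \<comment> \<open>Using \<open>bulk\<close> forwards and \<open>shear\<close> backwards eliminates \<open>s * ?b'\<close>.\<close>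
  have "(?b * (\<mu> 0)\<^sup>2) * (?b * (?K * \<mu>' 0)\<^sup>2) = (?b * (\<mu> 0)\<^sup>2) * (?b * (?K' * \<mu> 0)\<^sup>2)"
  proof -
    have "(?b * (\<mu> 0)\<^sup>2) * (?b * (?K * \<mu>' 0)\<^sup>2) = ?b * (\<mu> 0)\<^sup>2 * ((?b * ?K\<^sup>2) * (\<mu>' 0)\<^sup>2)"
      by (simp add: power_mult_distrib)
    also have "\<dots> = ?b * (\<mu> 0)\<^sup>2 * ((s * ?b' * (\<mu>' 0)\<^sup>2) * ?K'\<^sup>2)"
      unfolding bulk by simp
    also have "\<dots> = (?b * (\<mu> 0)\<^sup>2) * (?b * (?K' * \<mu> 0)\<^sup>2)"
      unfolding shear[symmetric] by (simp add: power_mult_distrib)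
    finally show ?thesis .
  qed
  then have "(?K * \<mu>' 0)\<^sup>2 = (?K' * \<mu> 0)\<^sup>2" using pos by simp
  moreover have "?K * \<mu>' 0 \<ge> 0" "?K' * \<mu> 0 \<ge> 0"
    by (rule mult_nonneg_nonneg; rule less_imp_le; rule pos)+
  ultimately have "?K * \<mu>' 0 = ?K' * \<mu> 0" by (rule power2_eq_imp_eq)
  then have "lam 0 * \<mu>' 0 = lam' 0 * \<mu> 0" by (simp add: algebra_simps)
  then have "\<mu> 0 / \<mu>' 0 * lam' 0 = lam 0" "\<mu> 0 / \<mu>' 0 * \<mu>' 0 = \<mu> 0"
    using pos by (simp_all add: field_simps)
  moreover have "char_root (\<mu> 0 / \<mu>' 0 * lam' 0) (\<mu> 0 / \<mu>' 0 * \<mu>' 0) k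
      = char_root (lam' 0) (\<mu>' 0) k" for k
    by (rule char_root_scale) (use pos in simp)
  ultimately show ?thesis by (intro ext) (simp only:)
qed

theorem theorem5p2:
  fixes n k1 k2 :: nat and R :: real
    and \<eta> lam \<mu> \<tau> \<kappa> \<eta>' lam' \<mu>' \<tau>' \<kappa>' :: "nat \<Rightarrow> real"
    and v q v' q' :: "nat \<Rightarrow> real vec"
  assumes "n \<ge> 1" and "R > 0"
    and "burgers_model n \<eta> lam \<mu>" and "ordered_spectrum n \<eta> lam \<mu> \<tau> v \<kappa> q"
    and "burgers_model n \<eta>' lam' \<mu>'" and "ordered_spectrum n \<eta>' lam' \<mu>' \<tau>' v' \<kappa>' q'"
    and "k1 \<ge> 1" and "k2 \<ge> 1" and "k1 \<noteq> k2"
    and "cluster n R lam \<mu> \<tau> v \<kappa> q k1 = cluster n R lam' \<mu>' \<tau>' v' \<kappa>' q' k1"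
    and "cluster n R lam \<mu> \<tau> v \<kappa> q k2 = cluster n R lam' \<mu>' \<tau>' v' \<kappa>' q' k2"
  shows "(\<forall>j\<in>{1..2*n+2}. alpha n lam \<mu> \<tau> v \<kappa> q j = alpha n lam' \<mu>' \<tau>' v' \<kappa>' q' j
            \<and> beta n \<tau> \<kappa> j = beta n \<tau>' \<kappa>' j)
         \<and> lam 0 + 2 * \<mu> 0 = lam' 0 + 2 * \<mu>' 0"
proof -
  interpret M: relaxation_spectrum n \<eta> lam \<mu> \<tau> \<kappa> v q
    using assms by unfold_locales
  interpret M': relaxation_spectrum n \<eta>' lam' \<mu>' \<tau>' \<kappa>' v' q'
    using assms by unfold_locales
  note both = M.relaxation_spectrum_axioms M'.relaxation_spectrum_axioms
  let ?J = "{1..2 * n + 2}"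
  let ?E = "pole_sum ?J M.b (\<lambda>i. M.a i / M.b i)" and ?E' = "pole_sum ?J M'.b (\<lambda>i. M'.a i / M'.b i)"
  let ?t = "\<lambda>k. (M.root k)\<^sup>2 / R\<^sup>2" and ?t' = "\<lambda>k. (M'.root k)\<^sup>2 / R\<^sup>2"
  have t_neq: "?t k1 \<noteq> ?t k2"
    using M.root_neq[of k1 k2] M.root_pos[of k1] M.root_pos[of k2] assms by simp
  have "poly ?E' 0 > 0"
    using M'.sum_a_over_b M'.wave_modulus_pos M'.b_pos M'.a_nonneg
    by (intro poly_pole_sum_0_pos) (auto simp: less_imp_le)
  then have E'_neq: "poly ?E' 0 \<noteq> 0" by simp
  obtain s where E: "?E = Polynomial.smult s ?E'"
    and B: "node_poly ?J M.b = node_poly ?J M'.b" and t: "?t' k1 = s * ?t k1"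
    by (rule two_normalised_clusters_rigid
      [OF cluster_eq_imp_normalised_eq[OF both \<open>R > 0\<close> \<open>k1 \<ge> 1\<close> assms(10)]
        cluster_eq_imp_normalised_eq[OF both \<open>R > 0\<close> \<open>k2 \<ge> 1\<close> assms(11)] t_neq E'_neq])
  have "(\<lambda>j. - M.b j) ` ?J = (\<lambda>j. - M'.b j) ` ?J"
    using B by (simp flip: node_poly_roots)
  then have "uminus ` (\<lambda>j. - M.b j) ` ?J = uminus ` (\<lambda>j. - M'.b j) ` ?J"
    by simp
  then have "M.b ` ?J = M'.b ` ?J" by (simp add: image_image)
  then have b: "M.b j = M'.b j" if "j \<in> ?J" for j
    using strict_mono_same_image M.strict_mono_b M'.strict_mono_b that by blast
  have "?E = pole_sum ?J M'.b (\<lambda>i. M.a i / M.b i)"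
    unfolding pole_sum_def node_poly_def using b
    by (intro sum.cong arg_cong2[of _ _ _ _ Polynomial.smult] prod.cong) auto
  then have w: "M.a i / M.b i = s * (M'.a i / M'.b i)" if "i \<in> ?J" for i
    using pole_sum_proportional_imp_weights[of ?J M'.b "\<lambda>i. M.a i / M.b i" s "\<lambda>i. M'.a i / M'.b i" i]
      E M'.strict_mono_b[THEN strict_mono_on_imp_inj_on] that by simp
  have a: "M.a i = s * M'.a i" if "i \<in> ?J" for i
    using w[OF that] b[OF that] M'.b_pos[OF that] by simp
  have "M.root = M'.root"
    using proportional_residues_imp_same_roots[OF both] a by blast
  then have s: "s = 1"
    using t M'.root_pos[of k1] assms by simp
  have "M.wave_modulus = M'.wave_modulus"
    unfolding M.sum_a_over_b[symmetric] M'.sum_a_over_b[symmetric]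
    using w s by (intro sum.cong) auto
  then show ?thesis using a b s by simp
qed

end
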